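(* Let $(\Pi,\Sigma)$ be a Coxeter system, $Q=(\sigma_1,\ldots,\sigma_m)$ a word in $\Sigma$, $\pi\in\Pi$, and $\ell=\mathrm{length}(\pi)$. Let $\Delta=\Delta(Q,\pi)$ be the subword complex and let $\Bbbk$ be a field. Then the Hilbert series of the Stanley--Reisner ring $\Bbbk[\Delta]$ is $$H(\Bbbk[\Delta];\mathbf z)=\frac{\sum_{P\subseteq Q,\ \delta(P)=\pi}(-1)^{|P|-\ell}(\mathbf 1-\mathbf z)^P}{\prod_{i=1}^m(1-z_i)},$$ where $(\mathbf 1-\mathbf z)^P=\prod_{\sigma_i\in P}(1-z_i)$ and the sum is over all subwords $P\subseteq Q$ with Demazure product $\delta(P)=\pi$.
   Context: Let $(\Pi,\Sigma)$ be a Coxeter system: $\Pi$ is a Coxeter group with set $\Sigma$ of simple reflections, and $\mathrm{length}$ is the length function with respect to $\Sigma$. A word of size $m$ is an ordered sequence $Q=(\sigma_1,\ldots,\sigma_m)$ of elements of $\Sigma$ (not necessarily a reduced expression). A subword $P$ of $Q$ is an ordered subsequence, remembered together with its positions in $Q$; thus subwords correspond to subsets of $\{1,\ldots,m\}$, "$\sigma_i\in P$" means that position $i$ belongs to $P$, and $Q\smallsetminus P$ denotes the subword on the complementary positions. $|P|$ is the number of positions in $P$. $P$ represents $\pi\in\Pi$ if the ordered product of the simple reflections in $P$ is a reduced decomposition of $\pi$; $P$ contains $\pi$ if some subsequence of $P$ represents $\pi$. The subword complex $\Delta(Q,\pi)$ is the simplicial complex whose faces are the subwords $Q\smallsetminus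 P$ whose complements $P$ contain $\pi$; faces are regarded as subsets of $\{1,\ldots,m\}$. Demazure product: for $\tau\in\Pi$ and $\sigma\in\Sigma$ put $\tau*\sigma=\tau\sigma$ if $\mathrm{length}(\tau\sigma)>\mathrm{length}(\tau)$ and $\tau*\sigma=\tau$ if $\mathrm{length}(\tau\sigma)<\mathrm{length}(\tau)$. The Demazure product of a word $P=(\tau_1,\ldots,\tau_k)$ is $\delta(P)=(\cdots((1*\tau_1)*\tau_2)\cdots)*\tau_k$, where $1$ is the identity of $\Pi$. Let $\Bbbk[\mathbf z]=\Bbbk[z_1,\ldots,z_m]$. The Stanley--Reisner ideal of $\Delta$ is $I_\Delta=\langle\prod_{i\in D}z_i\mid D\subseteq\{1,\dots,m\},\ D\notin\Delta\rangle$, the Stanley--Reisner ring is $\Bbbk[\Delta]=\Bbbk[\mathbf z]/I_\Delta$, and its ($\mathbb Z^m$-graded) Hilbert series $H(\Bbbk[\Delta];\mathbf z)$ is the formal power series equal to the sum of all monomials of $\Bbbk[\mathbf z]$ lying outside $I_\Delta$. *)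

theory Defs
  imports
    "HOL-Algebra.Ideal"
    "HOL-Library.Poly_Mapping"
    "HOL-Library.Extended_Nat"
begin

definition word_prod :: "('a, 'b) monoid_scheme \<Rightarrow> 'a list \<Rightarrow> 'a" where
  "word_prod G w = foldr (mult G) w (one G)"

definition coxeter_matrix :: "'a set \<Rightarrow> ('a \<Rightarrow> 'a \<Rightarrow> enat) \<Rightarrow> bool" where
  "coxeter_matrix S m \<longleftrightarrow>
     (\<forall>s\<in>S. \<forall>t\<in>S. m s t = m t s \<and> m s t \<noteq> 0 \<and> (m s t = 1 \<longleftrightarrow> s = t))"

text \<open>
  Equality of words over \<open>S\<close> in the group presented by the generators \<open>S\<close> and the relators
  \<open>(s t)^m(s,t)\<close> for \<open>m(s,t) < \<infinity>\<close>: words are identified when they differ by finitely many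
  insertions and deletions of relators.  The relators include \<open>s s\<close> (from \<open>m(s,s) = 1\<close>), so
  every generator is its own inverse and words without formal inverses suffice.
\<close>

inductive coxeter_equiv :: "'a set \<Rightarrow> ('a \<Rightarrow> 'a \<Rightarrow> enat) \<Rightarrow> 'a list \<Rightarrow> 'a list \<Rightarrow> bool"
  for S m where
  relator: "\<lbrakk>s \<in> S; t \<in> S; m s t = enat k\<rbrakk> \<Longrightarrow>
     coxeter_equiv S m (u @ concat (replicate k [s, t]) @ v) (u @ v)"
| refl: "coxeter_equiv S m u u"
| sym: "coxeter_equiv S m u v \<Longrightarrow> coxeter_equiv S m v u"
| trans: "\<lbrakk>coxeter_equiv S m u v; coxeter_equiv S m v w\<rbrakk> \<Longrightarrow> coxeter_equiv S m u w"

locale coxeter_system = group G for G (structure) +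
  fixes S :: "'a set"
  assumes simple_closed: "S \<subseteq> carrier G"
    and generated: "carrier G = word_prod G ` lists S"
    and presented: "\<exists>m. coxeter_matrix S m \<and>
      (\<forall>u\<in>lists S. \<forall>v\<in>lists S. word_prod G u = word_prod G v \<longleftrightarrow> coxeter_equiv S m u v)"

definition cox_length :: "('a, 'b) monoid_scheme \<Rightarrow> 'a set \<Rightarrow> 'a \<Rightarrow> nat" where
  "cox_length G S g = (LEAST n. \<exists>w\<in>lists S. length w = n \<and> word_prod G w = g)"

text \<open>
  Positions are counted from \<open>0\<close>, so the subwords of \<open>Q\<close> are the sets
  \<open>P \<subseteq> {..<length Q}\<close>, and \<open>nths Q P\<close> is the word that they spell.
\<close>

definition represents ::
    "('a, 'b) monoid_scheme \<Rightarrow> 'a set \<Rightarrow> 'a list \<Rightarrow> nat set \<Rightarrow> 'a \<Rightarrow> bool" where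
  "represents G S Q P g \<longleftrightarrow>
     word_prod G (nths Q P) = g \<and> length (nths Q P) = cox_length G S g"

definition contains ::
    "('a, 'b) monoid_scheme \<Rightarrow> 'a set \<Rightarrow> 'a list \<Rightarrow> nat set \<Rightarrow> 'a \<Rightarrow> bool" where
  "contains G S Q P g \<longleftrightarrow> (\<exists>P'\<subseteq>P. represents G S Q P' g)"

definition subword_complex ::
    "('a, 'b) monoid_scheme \<Rightarrow> 'a set \<Rightarrow> 'a list \<Rightarrow> 'a \<Rightarrow> nat set set" where
  "subword_complex G S Q g =
     {{..<length Q} - P | P. P \<subseteq> {..<length Q} \<and> contains G S Q P g}"

text \<open>
  In a Coxeter system \<open>g s\<close> and \<open>g\<close> never have equal length, so the second branch below is the
  case that the length decreases.  The Demazure product of a word \<open>w\<close> has length at most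
  \<open>length w\<close>.
\<close>

definition demazure_step :: "('a, 'b) monoid_scheme \<Rightarrow> 'a set \<Rightarrow> 'a \<Rightarrow> 'a \<Rightarrow> 'a" where
  "demazure_step G S g s =
     (if cox_length G S (g \<otimes>\<^bsub>G\<^esub> s) > cox_length G S g then g \<otimes>\<^bsub>G\<^esub> s else g)"

definition demazure :: "('a, 'b) monoid_scheme \<Rightarrow> 'a set \<Rightarrow> 'a list \<Rightarrow> 'a" where
  "demazure G S w = foldl (demazure_step G S) \<one>\<^bsub>G\<^esub> w"

text \<open>
  The type below is a polynomial ring in all variables \<open>z i\<close>, \<open>i :: nat\<close>; the polynomial ring in
  \<open>m\<close> variables is its subring on \<open>z 0, \<dots>, z (m - 1)\<close>.
\<close>

type_synonym 'k mpoly = "(nat \<Rightarrow>\<^sub>0 nat) \<Rightarrow>\<^sub>0 'k"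

definition monomials :: "nat \<Rightarrow> (nat \<Rightarrow>\<^sub>0 nat) set" where
  "monomials m = {a. Poly_Mapping.keys a \<subseteq> {..<m}}"

definition mpoly_ring :: "nat \<Rightarrow> 'k::field mpoly ring" where
  "mpoly_ring m =
     \<lparr>carrier = {p. Poly_Mapping.keys p \<subseteq> monomials m}, mult = (*), one = 1, zero = 0, add = (+)\<rparr>"

definition mpoly_var :: "nat \<Rightarrow> 'k::field mpoly" where
  "mpoly_var i = Poly_Mapping.single (Poly_Mapping.single i 1) 1"

definition stanley_reisner_ideal :: "nat \<Rightarrow> nat set set \<Rightarrow> 'k::field mpoly set" where
  "stanley_reisner_ideal m \<Delta> =
     Idl\<^bsub>mpoly_ring m\<^esub> {\<Prod>i\<in>D. mpoly_var i | D. D \<subseteq> {..<m} \<and> D \<notin> \<Delta>}"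

lemma cring_mpoly_ring: "cring (mpoly_ring m :: 'k::field mpoly ring)"
proof (rule cringI)
  show "abelian_group (mpoly_ring m :: 'k mpoly ring)"
  proof (rule abelian_groupI)
    fix x :: "'k mpoly"
    assume "x \<in> carrier (mpoly_ring m)"
    then show "\<exists>y\<in>carrier (mpoly_ring m). y \<oplus>\<^bsub>mpoly_ring m\<^esub> x = \<zero>\<^bsub>mpoly_ring m\<^esub>"
      by (intro bexI[of _ "- x"]) (auto simp: mpoly_ring_def)
  qed (use Poly_Mapping.keys_add in \<open>fastforce simp: mpoly_ring_def add_ac\<close>)+
  have closed: "x * y \<in> carrier (mpoly_ring m)"
    if xy: "x \<in> carrier (mpoly_ring m)" "y \<in> carrier (mpoly_ring m)" for x y :: "'k mpoly"
  proof -
    have "a + b \<in> monomials m" if "a \<in> Poly_Mapping.keys x" "b \<in> Poly_Mapping.keys y" for a b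
      using xy that keys_add[of a b] by (fastforce simp: mpoly_ring_def monomials_def)
    then have "Poly_Mapping.keys (x * y) \<subseteq> monomials m"
      using keys_mult[of x y] by blast
    then show ?thesis
      by (simp add: mpoly_ring_def)
  qed
  show "comm_monoid (mpoly_ring m :: 'k mpoly ring)"
    by (rule comm_monoidI) (use closed in \<open>auto simp: mpoly_ring_def monomials_def mult_ac\<close>)
qed (auto simp: mpoly_ring_def algebra_simps)

typedef ('i, 'a) mfps = "UNIV :: (('i \<Rightarrow>\<^sub>0 nat) \<Rightarrow> 'a) set"
  morphisms mfps_nth Abs_mfps
  by simp

setup_lifting type_definition_mfps

lemma mfps_eqI: "(\<And>a. mfps_nth f a = mfps_nth g a) \<Longrightarrow> f = g"
  by transfer auto

lemma mfps_nth_Abs [simp]: "mfps_nth (Abs_mfps f) a = f a"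
  by (simp add: Abs_mfps_inverse)

definition splits :: "('i \<Rightarrow>\<^sub>0 nat) \<Rightarrow> (('i \<Rightarrow>\<^sub>0 nat) \<times> ('i \<Rightarrow>\<^sub>0 nat)) set" where
  "splits a = {(b, c). b + c = a}"

lemma in_splits_iff: "(b, c) \<in> splits a \<longleftrightarrow> b + c = a"
  by (simp add: splits_def)

lemma finite_splits [simp]: "finite (splits a)"
proof -
  let ?B = "{b. \<forall>i. Poly_Mapping.lookup b i \<le> Poly_Mapping.lookup a i}"
  let ?M = "Max (insert 0 (Poly_Mapping.lookup a ` Poly_Mapping.keys a))"
  let ?F = "{f. \<forall>i. (i \<in> Poly_Mapping.keys a \<longrightarrow> f i \<in> {..?M})
    \<and> (i \<notin> Poly_Mapping.keys a \<longrightarrow> f i = (0::nat))}"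
  have "finite ?F"
    by (rule finite_set_of_finite_funs) auto
  moreover have "Poly_Mapping.lookup ` ?B \<subseteq> ?F"
  proof clarify
    fix b i
    assume le: "\<forall>i. Poly_Mapping.lookup b i \<le> Poly_Mapping.lookup a i"
    have "Poly_Mapping.lookup b i \<le> ?M" if "i \<in> Poly_Mapping.keys a"
      using that le by (intro order_trans[OF le[rule_format]] Max_ge) auto
    moreover have "Poly_Mapping.lookup b i = 0" if "i \<notin> Poly_Mapping.keys a"
      using that le[rule_format, of i] by (simp add: in_keys_iff)
    ultimately show "(i \<in> Poly_Mapping.keys a \<longrightarrow> Poly_Mapping.lookup b i \<in> {..?M})
        \<and> (i \<notin> Poly_Mapping.keys a \<longrightarrow> Poly_Mapping.lookup b i = 0)"
      by simp
  qed
  ultimately have "finite (Poly_Mapping.lookup ` ?B)"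
    by (rule rev_finite_subset)
  moreover have "inj_on Poly_Mapping.lookup ?B"
    by (auto intro: inj_onI poly_mapping_eqI)
  ultimately have "finite ?B"
    by (rule finite_imageD)
  moreover have "splits a \<subseteq> ?B \<times> ?B"
    by (auto simp: splits_def lookup_add)
  ultimately show ?thesis
    by (blast intro: finite_subset)
qed

instantiation mfps :: (type, comm_ring_1) comm_ring_1
begin

lift_definition zero_mfps :: "('a, 'b) mfps" is "\<lambda>_. 0" .
lift_definition one_mfps :: "('a, 'b) mfps" is "\<lambda>a. if a = 0 then 1 else 0" .
lift_definition plus_mfps :: "('a, 'b) mfps \<Rightarrow> ('a, 'b) mfps \<Rightarrow> ('a, 'b) mfps"
  is "\<lambda>f g a. f a + g a" .
lift_definition minus_mfps :: "('a, 'b) mfps \<Rightarrow> ('a, 'b) mfps \<Rightarrow> ('a, 'b) mfps"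
  is "\<lambda>f g a. f a - g a" .
lift_definition uminus_mfps :: "('a, 'b) mfps \<Rightarrow> ('a, 'b) mfps"
  is "\<lambda>f a. - f a" .
lift_definition times_mfps :: "('a, 'b) mfps \<Rightarrow> ('a, 'b) mfps \<Rightarrow> ('a, 'b) mfps"
  is "\<lambda>f g a. \<Sum>(b, c)\<in>splits a. f b * g c" .

instance
proof
  fix f g h :: "('a, 'b) mfps"
  show "f * g * h = f * (g * h)"
  proof (transfer, rule ext)
    fix f g h :: "('a \<Rightarrow>\<^sub>0 nat) \<Rightarrow> 'b" and a
    have "(\<Sum>(b, c)\<in>splits a. (\<Sum>(d, e)\<in>splits b. f d * g e) * h c)
        = (\<Sum>(p, q)\<in>Sigma (splits a) (\<lambda>p. splits (fst p)). f (fst q) * g (snd q) * h (snd p))"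
      by (subst sum.Sigma [symmetric])
        (auto simp: sum_distrib_right case_prod_beta intro!: sum.cong)
    also have "\<dots> = (\<Sum>(p, q)\<in>Sigma (splits a) (\<lambda>p. splits (snd p)).
        f (fst p) * (g (fst q) * h (snd q)))"
      by (rule sum.reindex_bij_witness[of _
            "\<lambda>(p, q). ((fst p + fst q, snd q), (fst p, fst q))"
            "\<lambda>(p, q). ((fst q, snd q + snd p), (snd q, snd p))"])
        (auto simp: splits_def ac_simps)
    also have "\<dots> = (\<Sum>(b, c)\<in>splits a. f b * (\<Sum>(d, e)\<in>splits c. g d * h e))"
      by (subst sum.Sigma [symmetric])
        (auto simp: sum_distrib_left case_prod_beta intro!: sum.cong)
    finally show "(\<Sum>(b, c)\<in>splits a. (\<Sum>(d, e)\<in>splits b. f d * g e) * h c)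
        = (\<Sum>(b, c)\<in>splits a. f b * (\<Sum>(d, e)\<in>splits c. g d * h e))" .
  qed
  show "f * g = g * f"
  proof (transfer, rule ext)
    fix f g :: "('a \<Rightarrow>\<^sub>0 nat) \<Rightarrow> 'b" and a
    show "(\<Sum>(b, c)\<in>splits a. f b * g c) = (\<Sum>(b, c)\<in>splits a. g b * f c)"
      by (rule sum.reindex_bij_witness[of _ prod.swap prod.swap])
        (auto simp: splits_def ac_simps)
  qed
  show "1 * f = f"
  proof (transfer, rule ext)
    fix f :: "('a \<Rightarrow>\<^sub>0 nat) \<Rightarrow> 'b" and a
    have "(\<Sum>(b, c)\<in>splits a. (if b = 0 then 1 else 0) * f c)
        = (\<Sum>(b, c)\<in>{(0 :: 'a \<Rightarrow>\<^sub>0 nat, a)}. (if b = 0 then 1 else 0) * f c)"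
      by (rule sum.mono_neutral_right) (auto simp: in_splits_iff split: if_splits)
    then show "(\<Sum>(b, c)\<in>splits a. (if b = 0 then 1 else 0) * f c) = f a"
      by simp
  qed
  show "(f + g) * h = f * h + g * h"
    by transfer (auto simp: case_prod_beta distrib_right sum.distrib)
  show "(0 :: ('a, 'b) mfps) \<noteq> 1"
    by transfer (auto dest: fun_cong[of _ _ 0])
qed (transfer, auto simp: algebra_simps)+

end

text \<open>Division by a unit is the usual one; as in any total inverse, non-units are inverted to \<open>0\<close>.\<close>

instantiation mfps :: (type, comm_ring_1) inverse
begin

definition inverse_mfps :: "('a, 'b) mfps \<Rightarrow> ('a, 'b) mfps" where
  "inverse_mfps f = (if f dvd 1 then THE g. f * g = 1 else 0)"

definition divide_mfps :: "('a, 'b) mfps \<Rightarrow> ('a, 'b) mfps \<Rightarrow> ('a, 'b) mfps" where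
  "divide_mfps f g = f * inverse g"

instance ..

end

lemma mfps_mult_inverse:
  fixes f :: "('i, 'a::comm_ring_1) mfps"
  assumes "f dvd 1"
  shows "f * inverse f = 1"
proof -
  obtain g where g: "f * g = 1"
    using assms by (metis dvdE)
  have "h = g" if "f * h = 1" for h
    using that g by (metis mult.left_commute mult.right_neutral)
  with g have "(THE g. f * g = 1) = g"
    by blast
  with assms g show ?thesis
    by (simp add: inverse_mfps_def)
qed

definition mfps_var :: "'i \<Rightarrow> ('i, 'a::comm_ring_1) mfps" where
  "mfps_var i = Abs_mfps (\<lambda>a. if a = Poly_Mapping.single i 1 then 1 else 0)"

lemma one_minus_mfps_var_unit: "(1 - mfps_var i :: ('i, 'a::comm_ring_1) mfps) dvd 1"
proof -
  let ?e = "Poly_Mapping.single i (1::nat)"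
  let ?P = "\<lambda>a. Poly_Mapping.keys a \<subseteq> {i}"
  define g :: "('i, 'a) mfps" where "g = Abs_mfps (\<lambda>a. if ?P a then 1 else 0)"
  have "mfps_nth (mfps_var i * g) a = (if ?P a \<and> a \<noteq> 0 then 1 else 0)" for a
  proof -
    have nth: "mfps_nth (mfps_var i * g) a
        = (\<Sum>(b, c)\<in>splits a. if b = ?e \<and> ?P c then 1 else 0)"
      by (auto simp: times_mfps.rep_eq mfps_var_def g_def intro!: sum.cong)
    show ?thesis
    proof (cases "?P a \<and> a \<noteq> 0")
      case True
      define c where "c = Poly_Mapping.single i (Poly_Mapping.lookup a i - 1)"
      have "Poly_Mapping.lookup a i \<noteq> 0"
        using True by (metis keys_eq_empty in_keys_iff subset_singleton_iff singletonI)
      moreover have "Poly_Mapping.lookup a j = 0" if "j \<noteq> i" for j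
        using True that by (auto simp: in_keys_iff)
      ultimately have c: "?e + c = a"
        by (intro poly_mapping_eqI) (auto simp: c_def lookup_add lookup_single when_def)
      have "(\<Sum>(b, c)\<in>splits a. if b = ?e \<and> ?P c then 1 else 0 :: 'a)
          = (\<Sum>(b, c)\<in>{(?e, c)}. if b = ?e \<and> ?P c then 1 else 0)"
        using c by (intro sum.mono_neutral_right)
          (auto simp: in_splits_iff simp del: One_nat_def split: if_splits)
      also have "\<dots> = 1"
        by (simp add: c_def)
      finally show ?thesis
        using True nth by simp
    next
      case False
      have "\<not> (b = ?e \<and> ?P c)" if "(b, c) \<in> splits a" for b c
      proof
        assume *: "b = ?e \<and> ?P c"
        then have a: "a = ?e + c"
          using that by (simp add: splits_def)
        then have "Poly_Mapping.lookup a i \<noteq> 0"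
          by (simp add: lookup_add)
        moreover have "?P a"
          using * a keys_add[of ?e c] by (auto split: if_splits)
        ultimately show False
          using False by auto
      qed
      then show ?thesis
        using False nth by (auto intro!: sum.neutral)
    qed
  qed
  then have "(1 - mfps_var i) * g = 1"
    by (intro mfps_eqI) (auto simp: left_diff_distrib minus_mfps.rep_eq one_mfps.rep_eq g_def)
  then show ?thesis
    by (metis dvdI)
qed

text \<open>
  The Hilbert series of \<open>k[z 0, \<dots>, z (m - 1)] / I\<close> for a monomial ideal \<open>I\<close>: the sum of all
  monomials outside \<open>I\<close>.
\<close>

definition hilbert_series :: "nat \<Rightarrow> 'k::field mpoly set \<Rightarrow> (nat, int) mfps" where
  "hilbert_series m I =
     Abs_mfps (\<lambda>a. if a \<in> monomials m \<and> Poly_Mapping.single a 1 \<notin> I then 1 else 0)"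

end

theory Submission
  imports Defs "HOL-Library.Sublist"
begin

text \<open>
  Write \<open>\<Delta>\<close> for the subword complex and \<open>z^F\<close>, \<open>(1 - z)^P\<close> for products over sets
  of positions.  A monomial lies outside the Stanley--Reisner ideal exactly when its support is a
  face, and the monomials with support \<open>F\<close> sum to the product of the \<open>z\<^sub>i / (1 - z\<^sub>i)\<close> over
  \<open>i \<in> F\<close>.  Multiplying the Hilbert series by the product of all \<open>1 - z\<^sub>i\<close> therefore leaves
  the sum of \<open>z^F (1 - z)^(Q - F)\<close> over the faces \<open>F\<close>
  (lemma \<open>hilbert_series_numerator\<close>).  Indexed by the complements of the faces, this is the
  sum of \<open>(1 - z)^P z^(Q - P)\<close> over the subwords \<open>P\<close> that contain \<open>g\<close>.

  It remains to see that this polynomial in the weights \<open>1 - z\<^sub>i\<close> is the signed sum over the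
  subwords with Demazure product \<open>g\<close> (lemma \<open>demazure_expansion\<close>).  Rather than using
  the Bruhat order or the topology of the complex, the proof observes that both sides obey one
  recursion on the last letter \<open>s\<close> of \<open>Q\<close>, which distinguishes whether \<open>g s\<close> is
  shorter than \<open>g\<close>.  For subwords that contain \<open>g\<close> this recursion rests on the following
  fact: if \<open>g s\<close> is shorter than \<open>g\<close>, then a word that contains \<open>g\<close> also contains
  \<open>g s\<close>.  This is the exchange property (lemma \<open>exchange\<close>).

  The exchange property in turn is derived from the presentation.  Each word determines a list of
  reflections, one for each letter, such that right multiplication by a reflection of the list
  deletes the corresponding letter.  The parity with which a reflection occurs in the list depends
  only on the group element (lemma \<open>parity_count_refls\<close>), because in a relator
  \<open>(s t)^k\<close> every reflection occurs an even number of times.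
\<close>

section \<open>Reflections of a word and the exchange property\<close>

text \<open>
  An equivalence of words may pass through intermediate words, while the defining property of a
  Coxeter system speaks only about words in the generators.  Since relators are spelled with
  generators, an equivalence that starts in \<open>lists S\<close> never leaves it.
\<close>

lemma coxeter_equiv_lists:
  "coxeter_equiv S m u v \<Longrightarrow> u \<in> lists S \<longleftrightarrow> v \<in> lists S"
  by (induction rule: coxeter_equiv.induct) (auto split: if_splits)

text \<open>
  Every relator \<open>(s t)^k\<close> has even length.  This is the sign character of the Coxeter group,
  and it is what forbids \<open>h s\<close> and \<open>h\<close> to have the same length.
\<close>

lemma coxeter_equiv_length_parity:
  "coxeter_equiv S m u v \<Longrightarrow> even (length u) = even (length v)"
  by (induction rule: coxeter_equiv.induct) (auto simp: length_concat sum_list_replicate)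

lemma count_list_map_conv_on:
  assumes "inj_on f A" "set xs \<subseteq> A" "x \<in> A"
  shows "count_list (map f xs) (f x) = count_list xs x"
  using assms(2) by (induction xs) (auto dest: inj_onD[OF assms(1)] simp: assms(3))

lemma word_prod_Nil [simp]: "word_prod G [] = \<one>\<^bsub>G\<^esub>"
  by (simp add: word_prod_def)

lemma word_prod_Cons [simp]: "word_prod G (x # w) = x \<otimes>\<^bsub>G\<^esub> word_prod G w"
  by (simp add: word_prod_def)

text \<open>
  For \<open>w = s\<^sub>1 \<dots> s\<^sub>n\<close> this lists the reflections
  \<open>t\<^sub>i = (s\<^sub>i\<^sub>+\<^sub>1 \<dots> s\<^sub>n)\<inverse> s\<^sub>i (s\<^sub>i\<^sub>+\<^sub>1 \<dots> s\<^sub>n)\<close>: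
  multiplying \<open>w\<close> by \<open>t\<^sub>i\<close> on the right deletes its \<open>i\<close>-th letter.
  A reflection may occur several times when \<open>w\<close> is not reduced, so a list is needed.
\<close>

fun refls :: "('a, 'b) monoid_scheme \<Rightarrow> 'a list \<Rightarrow> 'a list" where
  "refls G [] = []"
| "refls G (x # w) = (inv\<^bsub>G\<^esub> word_prod G w \<otimes>\<^bsub>G\<^esub> (x \<otimes>\<^bsub>G\<^esub> word_prod G w)) # refls G w"

context group
begin

lemma inv_mult_cancel [simp]:
  assumes "h \<in> carrier G" "x \<in> carrier G"
  shows "inv h \<otimes> (h \<otimes> x) = x" "h \<otimes> (inv h \<otimes> x) = x"
  using assms by (simp_all flip: m_assoc)

lemma word_prod_closed [simp, intro]: "w \<in> lists (carrier G) \<Longrightarrow> word_prod G w \<in> carrier G"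
  by (induction w) auto

lemma word_prod_append:
  "\<lbrakk>u \<in> lists (carrier G); v \<in> lists (carrier G)\<rbrakk>
    \<Longrightarrow> word_prod G (u @ v) = word_prod G u \<otimes> word_prod G v"
  by (induction u) (auto simp: m_assoc)

lemma refls_closed: "w \<in> lists (carrier G) \<Longrightarrow> set (refls G w) \<subseteq> carrier G"
  by (induction w) auto

lemma refls_append:
  assumes "u \<in> lists (carrier G)" "v \<in> lists (carrier G)"
  shows "refls G (u @ v)
    = map (\<lambda>x. inv word_prod G v \<otimes> (x \<otimes> word_prod G v)) (refls G u) @ refls G v"
  using assms by (induction u) (auto simp: word_prod_append inv_mult_group m_assoc)

lemma inj_on_conj:
  assumes "h \<in> carrier G"
  shows "inj_on (\<lambda>x. inv h \<otimes> (x \<otimes> h)) (carrier G)"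
  using assms by (auto intro!: inj_onI)

lemma count_refls_append:
  assumes "u \<in> lists (carrier G)" "v \<in> lists (carrier G)" "t \<in> carrier G"
  shows "count_list (refls G (u @ v)) t
    = count_list (refls G u) (word_prod G v \<otimes> (t \<otimes> inv word_prod G v)) + count_list (refls G v) t"
proof -
  let ?h = "word_prod G v"
  have h: "?h \<in> carrier G" using assms by auto
  have t: "t = inv ?h \<otimes> ((?h \<otimes> (t \<otimes> inv ?h)) \<otimes> ?h)"
    using h assms(3) by (simp add: m_assoc)
  have "count_list (map (\<lambda>x. inv ?h \<otimes> (x \<otimes> ?h)) (refls G u)) t
      = count_list (refls G u) (?h \<otimes> (t \<otimes> inv ?h))"
    by (subst t, rule count_list_map_conv_on[OF inj_on_conj[OF h]])
      (use assms h refls_closed in auto)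
  then show ?thesis
    using assms by (simp add: refls_append)
qed

text \<open>
  If \<open>w = a x b\<close> and \<open>t = b\<inverse> x b\<close> for the letter \<open>x\<close>, then
  \<open>w t = a x b b\<inverse> x b = a x x b = a b\<close>.
\<close>

lemma deletion_of_refl:
  assumes "w \<in> lists (carrier G)" "t \<in> set (refls G w)" "\<And>x. x \<in> set w \<Longrightarrow> x \<otimes> x = \<one>"
  shows "\<exists>a x b. w = a @ x # b \<and> word_prod G w \<otimes> t = word_prod G (a @ b)"
  using assms
proof (induction w rule: list.induct)
  case (Cons y w)
  let ?h = "word_prod G w"
  have c: "y \<in> carrier G" "?h \<in> carrier G"
    using Cons.prems(1) by auto
  show ?case
  proof (cases "t \<in> set (refls G w)")
    case True
    then obtain a x b where w: "w = a @ x # b" "?h \<otimes> t = word_prod G (a @ b)"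
      using Cons by auto
    have "t \<in> carrier G"
      using True Cons.prems refls_closed by auto
    then have "word_prod G (y # w) \<otimes> t = word_prod G ((y # a) @ b)"
      using w(2) c by (simp add: m_assoc)
    then show ?thesis
      using w(1) by (metis append_Cons)
  next
    case False
    then have t: "t = inv ?h \<otimes> (y \<otimes> ?h)"
      using Cons.prems by auto
    have "word_prod G (y # w) \<otimes> t = y \<otimes> (?h \<otimes> (inv ?h \<otimes> (y \<otimes> ?h)))"
      unfolding t using c by (simp add: m_assoc)
    also have "\<dots> = (y \<otimes> y) \<otimes> ?h"
      using c by (simp add: m_assoc)
    also have "\<dots> = ?h"
      using c Cons.prems by simp
    finally show ?thesis
      by (intro exI[of _ "[]"]) auto
  qed
qed simp

text \<open>
  In the dihedral group generated by two involutions, the reflections of an alternating word are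
  the consecutive translates \<open>d^i t\<close> of \<open>t\<close> by the rotation \<open>d = t s\<close>; conjugation by
  \<open>t\<close> inverts \<open>d\<close>.
\<close>

lemma refls_dihedral:
  assumes st: "s \<in> carrier G" "t \<in> carrier G" "s \<otimes> s = \<one>" "t \<otimes> t = \<one>"
  shows "refls G (concat (replicate k [s, t])) = rev (map (\<lambda>i. (t \<otimes> s) [^] i \<otimes> t) [0..<2 * k])"
    and "word_prod G (concat (replicate k [s, t])) = inv ((t \<otimes> s) [^] k)"
proof -
  let ?w = "\<lambda>k. concat (replicate k [s, t])" and ?d = "t \<otimes> s"
  have inv: "inv s = s" "inv t = t"
    using st by (auto intro: inv_equality)
  have wp: "word_prod G (?w k) = inv (?d [^] k)" for k
  proof (induction k)
    case (Suc k)
    then show ?case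
      using st by (simp add: inv_mult_group m_assoc inv)
  qed simp
  show "word_prod G (?w k) = inv (?d [^] k)"
    by (rule wp)
  have tinv: "t \<otimes> inv (?d [^] k) = ?d [^] k \<otimes> t" for k :: nat
  proof (induction k)
    case (Suc k)
    have "t \<otimes> inv (?d [^] Suc k) = (t \<otimes> s) \<otimes> (t \<otimes> inv (?d [^] k))"
      using st by (simp add: inv_mult_group m_assoc inv)
    also have "\<dots> = (t \<otimes> s) \<otimes> (?d [^] k \<otimes> t)"
      by (simp only: Suc)
    also have "\<dots> = ?d [^] Suc k \<otimes> t"
      using st by (subst nat_pow_Suc2) (simp_all add: m_assoc)
    finally show ?case .
  qed (use st in simp)
  show "refls G (?w k) = rev (map (\<lambda>i. ?d [^] i \<otimes> t) [0..<2 * k])"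
  proof (induction k)
    case (Suc k)
    let ?e = "?d [^] k"
    have e: "?e \<in> carrier G" using st by simp
    have d2: "?d [^] (2 * k) = ?e \<otimes> ?e"
      using st by (simp add: mult_2 nat_pow_mult)
    then have B: "?e \<otimes> (t \<otimes> inv ?e) = ?d [^] (2 * k) \<otimes> t"
      using st e by (simp add: tinv m_assoc)
    have "inv (t \<otimes> inv ?e) \<otimes> (s \<otimes> (t \<otimes> inv ?e)) = ?e \<otimes> ((t \<otimes> s) \<otimes> (t \<otimes> inv ?e))"
      using st e by (simp add: inv_mult_group inv m_assoc)
    also have "\<dots> = (?e \<otimes> ?d) \<otimes> (?e \<otimes> t)"
      using st e by (simp add: tinv m_assoc)
    also have "\<dots> = ((?e \<otimes> ?d) \<otimes> ?e) \<otimes> t"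
      using st e by (simp add: m_assoc)
    also have "(?e \<otimes> ?d) \<otimes> ?e = ?d [^] Suc (2 * k)"
      using st nat_pow_mult[of ?d "Suc k" k] by (simp add: mult_2)
    finally show ?case
      using Suc B e st by (simp add: wp)
  qed simp
qed

text \<open>
  If the word \<open>(s t)^k\<close> is trivial then \<open>d^k = 1\<close>, so the sequence \<open>d^i t\<close> has period
  \<open>k\<close> and its first \<open>2 k\<close> terms consist of the first \<open>k\<close> terms, repeated.
\<close>

lemma even_count_refls_dihedral:
  assumes st: "s \<in> carrier G" "t \<in> carrier G" "s \<otimes> s = \<one>" "t \<otimes> t = \<one>"
    and one: "word_prod G (concat (replicate k [s, t])) = \<one>"
  shows "even (count_list (refls G (concat (replicate k [s, t]))) x)"
proof -
  let ?f = "\<lambda>i. (t \<otimes> s) [^] (i::nat) \<otimes> t"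
  have "(t \<otimes> s) [^] k = \<one>"
    using one st by (simp add: refls_dihedral)
  then have per: "?f (i + k) = ?f i" for i
    using st by (simp flip: nat_pow_mult)
  have "map ?f [0..<2 * k] = map ?f [0..<k] @ map ?f (map (\<lambda>i. i + k) [0..<k])"
    by (simp only: map_add_upt mult_2 upt_add_eq_append[of 0 k] le0 map_append add_0)
  also have "\<dots> = map ?f [0..<k] @ map ?f [0..<k]"
    by (simp only: map_map comp_def per)
  finally show ?thesis
    using st by (simp add: refls_dihedral)
qed

end

context coxeter_system
begin

lemma S_closed [simp]: "s \<in> S \<Longrightarrow> s \<in> carrier G"
  using simple_closed by auto

lemma lists_S_closed [simp, intro]: "w \<in> lists S \<Longrightarrow> w \<in> lists (carrier G)"
  using simple_closed by auto

lemma refl_sq: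
  assumes "s \<in> S"
  shows "s \<otimes> s = \<one>"
proof -
  obtain m where m: "coxeter_matrix S m"
    "\<And>u v. \<lbrakk>u \<in> lists S; v \<in> lists S\<rbrakk> \<Longrightarrow> word_prod G u = word_prod G v \<longleftrightarrow> coxeter_equiv S m u v"
    using presented by blast
  have "m s s = enat 1"
    using m(1) assms by (auto simp: coxeter_matrix_def one_enat_def)
  then have "coxeter_equiv S m ([] @ concat (replicate 1 [s, s]) @ []) ([] @ [])"
    using assms by (intro coxeter_equiv.relator)
  then show ?thesis
    using m(2)[of "[s, s]" "[]"] assms by simp
qed

text \<open>
  The parity with which a reflection occurs depends only on the element that the word spells.
  Inserting a relator \<open>r\<close> into \<open>u v\<close> leaves the contributions of \<open>u\<close> and \<open>v\<close>
  unchanged because \<open>r\<close> is trivial in the group, and \<open>r\<close> itself contributes an even number.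
  This parity replaces the usual geometric or permutation representation of a Coxeter group.
\<close>

lemma parity_count_refls:
  assumes "u \<in> lists S" "v \<in> lists S" "word_prod G u = word_prod G v" "t \<in> carrier G"
  shows "even (count_list (refls G u) t) = even (count_list (refls G v) t)"
proof -
  obtain m where
    m: "\<And>u v. \<lbrakk>u \<in> lists S; v \<in> lists S\<rbrakk> \<Longrightarrow> word_prod G u = word_prod G v \<longleftrightarrow> coxeter_equiv S m u v"
    using presented by blast
  have "even (count_list (refls G u) t) = even (count_list (refls G v) t)"
    if "coxeter_equiv S m u v" "u \<in> lists S" for u v
    using that
  proof (induction rule: coxeter_equiv.induct)
    case (relator s t' k u v)
    let ?r = "concat (replicate k [s, t'])"
    have uv: "u \<in> lists S" "?r \<in> lists S" "v \<in> lists S"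
      using relator.prems by auto
    have "coxeter_equiv S m ([] @ ?r @ []) ([] @ [])"
      using relator.hyps by (intro coxeter_equiv.relator)
    then have r: "word_prod G ?r = \<one>"
      using m[of ?r "[]"] uv by simp
    have "even (count_list (refls G ?r) x)" for x
      using relator.hyps r by (intro even_count_refls_dihedral refl_sq) auto
    moreover have "word_prod G (?r @ v) = word_prod G v"
      using uv r by (subst word_prod_append) (auto intro: word_prod_closed simp del: in_lists_conv_set)
    moreover have "count_list (refls G (u @ ?r @ v)) t
        = count_list (refls G u) (word_prod G (?r @ v) \<otimes> (t \<otimes> inv word_prod G (?r @ v)))
          + (count_list (refls G ?r) (word_prod G v \<otimes> (t \<otimes> inv word_prod G v))
             + count_list (refls G v) t)"
      using uv \<open>t \<in> carrier G\<close> lists_S_closed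
      by (simp only: count_refls_append append_in_lists_conv)
    moreover have "count_list (refls G (u @ v)) t
        = count_list (refls G u) (word_prod G v \<otimes> (t \<otimes> inv word_prod G v))
          + count_list (refls G v) t"
      using uv \<open>t \<in> carrier G\<close> lists_S_closed by (simp only: count_refls_append)
    ultimately show ?case
      by simp
  next
    case (trans u v w)
    then show ?case
      using coxeter_equiv_lists by metis
  next
    case (sym u v)
    then show ?case
      using coxeter_equiv_lists by metis
  qed simp
  with assms m show ?thesis
    by blast
qed

abbreviation len :: "'a \<Rightarrow> nat" where
  "len \<equiv> cox_length G S"

lemma reduced_word:
  assumes "h \<in> carrier G"
  obtains w where "w \<in> lists S" "length w = len h" "word_prod G w = h"
proof -
  obtain w where "w \<in> lists S" "word_prod G w = h"
    using assms generated by auto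
  then have "\<exists>n. \<exists>w\<in>lists S. length w = n \<and> word_prod G w = h"
    by auto
  then have "\<exists>w\<in>lists S. length w = len h \<and> word_prod G w = h"
    unfolding cox_length_def by (rule LeastI_ex)
  then show ?thesis
    using that by blast
qed

lemma len_le: "w \<in> lists S \<Longrightarrow> len (word_prod G w) \<le> length w"
  unfolding cox_length_def by (rule Least_le) auto

lemma mult_simple_cancel [simp]: "\<lbrakk>h \<in> carrier G; s \<in> S\<rbrakk> \<Longrightarrow> h \<otimes> s \<otimes> s = h"
  by (simp add: m_assoc refl_sq)

lemma word_prod_snoc:
  "\<lbrakk>w \<in> lists S; s \<in> S\<rbrakk> \<Longrightarrow> word_prod G (w @ [s]) = word_prod G w \<otimes> s"
  by (subst word_prod_append) auto

lemma len_mult_le: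
  assumes "h \<in> carrier G" "s \<in> S"
  shows "len (h \<otimes> s) \<le> Suc (len h)"
proof -
  obtain w where "w \<in> lists S" "length w = len h" "word_prod G w = h"
    using reduced_word assms by blast
  then show ?thesis
    using len_le[of "w @ [s]"] assms by (simp add: word_prod_snoc)
qed

lemma len_mult_ge:
  assumes "h \<in> carrier G" "s \<in> S"
  shows "len h \<le> Suc (len (h \<otimes> s))"
  using len_mult_le[of "h \<otimes> s" s] assms by simp

lemma len_mult_neq:
  assumes "h \<in> carrier G" "s \<in> S"
  shows "len (h \<otimes> s) \<noteq> len h"
proof
  assume eq: "len (h \<otimes> s) = len h"
  obtain m where
    m: "\<And>u v. \<lbrakk>u \<in> lists S; v \<in> lists S\<rbrakk> \<Longrightarrow> word_prod G u = word_prod G v \<longleftrightarrow> coxeter_equiv S m u v"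
    using presented by blast
  obtain w where w: "w \<in> lists S" "length w = len h" "word_prod G w = h"
    using reduced_word assms by blast
  obtain v where v: "v \<in> lists S" "length v = len (h \<otimes> s)" "word_prod G v = h \<otimes> s"
    using reduced_word[of "h \<otimes> s"] assms by auto
  have "coxeter_equiv S m (w @ [s]) v"
    using w v assms by (subst m[symmetric]) (auto simp: word_prod_snoc)
  from coxeter_equiv_length_parity[OF this] show False
    using w v eq by simp
qed

text \<open>
  Compare \<open>w\<close> with the word \<open>v s\<close> for a reduced word \<open>v\<close> of \<open>w s\<close>; both spell the
  same element.  The reflection \<open>s\<close> occurs once at the end of \<open>v s\<close>, and it cannot occur in
  \<open>v\<close>: deleting a letter of \<open>v\<close> would then spell the element of \<open>w\<close>, which is longer
  than that of \<open>v\<close>.  Hence \<open>s\<close> occurs an odd number of times in \<open>w\<close>, in particular at least once, and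
  the corresponding letter of \<open>w\<close> can be deleted.
\<close>

lemma exchange:
  assumes w: "w \<in> lists S" and s: "s \<in> S"
    and desc: "len (word_prod G w \<otimes> s) < len (word_prod G w)"
  obtains a x b where "w = a @ x # b" "word_prod G w \<otimes> s = word_prod G (a @ b)"
proof -
  let ?h = "word_prod G w"
  have h: "?h \<in> carrier G" using w by auto
  obtain v where v: "v \<in> lists S" "length v = len (?h \<otimes> s)" "word_prod G v = ?h \<otimes> s"
    using reduced_word[of "?h \<otimes> s"] h s by auto
  have del: "\<exists>a x b. u = a @ x # b \<and> word_prod G u \<otimes> s = word_prod G (a @ b)"
    if "u \<in> lists S" "s \<in> set (refls G u)" for u
    using that by (intro deletion_of_refl) (auto intro: refl_sq)
  have "s \<notin> set (refls G v)"
  proof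
    assume "s \<in> set (refls G v)"
    then obtain a x b where ab: "v = a @ x # b" "word_prod G v \<otimes> s = word_prod G (a @ b)"
      using del v(1) by blast
    then have "len ?h \<le> length (a @ b)"
      using len_le[of "a @ b"] v h s by simp
    then show False
      using desc v(2) ab(1) by simp
  qed
  then have "count_list (refls G v) s = 0"
    by (simp add: count_list_0_iff)
  then have "count_list (refls G (v @ [s])) s = 1"
    using v s by (simp add: count_refls_append lists_S_closed m_assoc[symmetric] refl_sq)
  moreover have "word_prod G (v @ [s]) = ?h"
    using v h s by (simp add: word_prod_snoc)
  ultimately have "odd (count_list (refls G w) s)"
    using parity_count_refls[of "v @ [s]" w s] v w s by simp
  then have "s \<in> set (refls G w)"
    by (metis count_list_0_iff even_zero)
  then show ?thesis
    using del w that by blast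
qed

end

section \<open>Subwords and Demazure products\<close>

lemma subseq_nths_mono: "A \<subseteq> B \<Longrightarrow> subseq (nths xs A) (nths xs B)"
proof (induction xs arbitrary: A B)
  case (Cons x xs)
  have "subseq (nths xs {j. Suc j \<in> A}) (nths xs {j. Suc j \<in> B})"
    using Cons.prems by (intro Cons.IH) auto
  then show ?case
    using Cons.prems by (auto simp: nths_Cons)
qed simp

lemma sum_Pow_lessThan_Suc:
  fixes f :: "nat set \<Rightarrow> 'r::comm_monoid_add"
  shows "(\<Sum>P\<in>Pow {..<Suc n}. f P)
    = (\<Sum>P\<in>Pow {..<n}. f P) + (\<Sum>P\<in>Pow {..<n}. f (insert n P))"
proof -
  have "(\<Sum>P\<in>Pow {..<Suc n}. f P)
      = (\<Sum>P\<in>Pow {..<n}. f P) + (\<Sum>P\<in>insert n ` Pow {..<n}. f P)"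
    unfolding lessThan_Suc Pow_insert by (rule sum.union_disjoint) auto
  also have "(\<Sum>P\<in>insert n ` Pow {..<n}. f P) = (\<Sum>P\<in>Pow {..<n}. f (insert n P))"
    by (subst sum.reindex) (auto intro!: inj_onI dest!: insert_ident[THEN iffD1, rotated 2])
  finally show ?thesis .
qed

lemma nths_snoc_old: "P \<subseteq> {..<length w} \<Longrightarrow> nths (w @ [x]) P = nths w P"
  by (auto simp: nths_append)

lemma nths_snoc_new: "P \<subseteq> {..<length w} \<Longrightarrow> nths (w @ [x]) (insert (length w) P) = nths w P @ [x]"
proof -
  assume P: "P \<subseteq> {..<length w}"
  have "nths w (insert (length w) P) = nths w P"
    unfolding nths_def by (intro arg_cong[where f = "map fst"] filter_cong) (auto dest: set_zip_rightD)
  then show ?thesis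
    by (simp add: nths_append)
qed

context coxeter_system
begin

text \<open>
  Containment of an element depends only on the word spelled by the chosen positions, and in this
  form a recursion on the last letter of the word is possible.
\<close>

definition reduced_subword :: "'a list \<Rightarrow> 'a \<Rightarrow> bool" where
  "reduced_subword w h \<longleftrightarrow> (\<exists>u. subseq u w \<and> word_prod G u = h \<and> length u = len h)"

lemma contains_iff_reduced_subword: "contains G S Q P h \<longleftrightarrow> reduced_subword (nths Q P) h"
proof
  assume "contains G S Q P h"
  then show "reduced_subword (nths Q P) h"
    unfolding contains_def represents_def reduced_subword_def using subseq_nths_mono by blast
next
  assume "reduced_subword (nths Q P) h"
  then obtain N where N: "word_prod G (nths (nths Q P) N) = h" "length (nths (nths Q P) N) = len h"
    unfolding reduced_subword_def subseq_conv_nths by blast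
  let ?P' = "{i \<in> P. \<exists>j\<in>N. card {i' \<in> P. i' < i} = j}"
  have "represents G S Q ?P' h"
    unfolding represents_def nths_nths[symmetric] using N by simp
  moreover have "?P' \<subseteq> P"
    by blast
  ultimately show "contains G S Q P h"
    unfolding contains_def by (intro exI[of _ ?P'] conjI)
qed

lemma subseq_lists: "subseq u w \<Longrightarrow> w \<in> lists A \<Longrightarrow> u \<in> lists A"
  using set_nths_subset[of w] by (auto simp: subseq_conv_nths)

text \<open>
  A reduced word of \<open>h\<close> inside \<open>w\<close> becomes, after the deletion provided by the exchange
  property, a reduced word of \<open>h s\<close> that still lies inside \<open>w\<close>.
\<close>

lemma reduced_subword_descend:
  assumes w: "w \<in> lists S" and s: "s \<in> S"
    and red: "reduced_subword w h" and desc: "len (h \<otimes> s) < len h"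
  shows "reduced_subword w (h \<otimes> s)"
proof -
  obtain u where u: "subseq u w" "word_prod G u = h" "length u = len h"
    using red unfolding reduced_subword_def by blast
  have uS: "u \<in> lists S"
    using u(1) w by (rule subseq_lists)
  then obtain a x b where ab: "u = a @ x # b" "h \<otimes> s = word_prod G (a @ b)"
    using exchange[of u s] s desc u(2) by blast
  have "subseq (a @ b) u"
    unfolding ab(1) by (simp only: subseq_append') auto
  then have "subseq (a @ b) w"
    using u(1) subseq_order.trans by blast
  moreover have "length (a @ b) = len (h \<otimes> s)"
  proof -
    have "len h \<le> Suc (len (h \<otimes> s))"
      using uS u(2) s by (intro len_mult_ge) auto
    then show ?thesis
      using u(3) ab(1) desc by simp
  qed
  ultimately show ?thesis
    using ab(2) unfolding reduced_subword_def by auto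
qed

text \<open>
  A reduced word of \<open>h\<close> in \<open>w s\<close> either avoids the last letter or ends in it.  The second
  case requires that \<open>s\<close> is a descent of \<open>h\<close>, and then the first case is subsumed
  by lemma \<open>reduced_subword_descend\<close>.
\<close>

lemma reduced_subword_snoc:
  assumes w: "w \<in> lists S" and s: "s \<in> S" and h: "h \<in> carrier G"
  shows "reduced_subword (w @ [s]) h \<longleftrightarrow>
    (if len (h \<otimes> s) < len h then reduced_subword w (h \<otimes> s) else reduced_subword w h)"
proof -
  have single: "subseq v [s] \<longleftrightarrow> v = [] \<or> v = [s]" for v
    by (cases v) auto
  have sub: "subseq u (w @ [s]) \<longleftrightarrow> subseq u w \<or> (\<exists>v. u = v @ [s] \<and> subseq v w)" for u
    unfolding subseq_append_iff single by auto
  have "reduced_subword (w @ [s]) h \<longleftrightarrow> reduced_subword w h \<or>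
      (\<exists>u. subseq u w \<and> word_prod G (u @ [s]) = h \<and> Suc (length u) = len h)"
    unfolding reduced_subword_def sub by (auto simp: ex_disj_distrib conj_disj_distribR)
  also have "(\<exists>u. subseq u w \<and> word_prod G (u @ [s]) = h \<and> Suc (length u) = len h) \<longleftrightarrow>
      len (h \<otimes> s) < len h \<and> reduced_subword w (h \<otimes> s)"
  proof -
    have "word_prod G (u @ [s]) = h \<and> Suc (length u) = len h \<longleftrightarrow>
        len (h \<otimes> s) < len h \<and> word_prod G u = h \<otimes> s \<and> length u = len (h \<otimes> s)"
      if u: "subseq u w" for u
    proof -
      have uS: "u \<in> lists S"
        using u w by (rule subseq_lists)
      then have uc: "word_prod G u \<in> carrier G"
        by auto
      have eq: "word_prod G (u @ [s]) = h \<longleftrightarrow> word_prod G u = h \<otimes> s"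
        using uS s h uc by (metis word_prod_snoc mult_simple_cancel)
      have "len (h \<otimes> s) \<le> length u" if "word_prod G u = h \<otimes> s"
        using len_le[OF uS] that by simp
      moreover have "len h \<le> Suc (len (h \<otimes> s))"
        using h s by (rule len_mult_ge)
      ultimately show ?thesis
        unfolding eq by auto
    qed
    then show ?thesis
      unfolding reduced_subword_def by blast
  qed
  finally show ?thesis
    using reduced_subword_descend[OF w s] by auto
qed

lemma demazure_step_closed: "\<lbrakk>h \<in> carrier G; s \<in> S\<rbrakk> \<Longrightarrow> demazure_step G S h s \<in> carrier G"
  by (simp add: demazure_step_def)

lemma demazure_snoc: "demazure G S (w @ [s]) = demazure_step G S (demazure G S w) s"
  by (simp add: demazure_def)

lemma demazure_closed: "w \<in> lists S \<Longrightarrow> demazure G S w \<in> carrier G"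
proof (induction w rule: rev_induct)
  case Nil
  show ?case by (simp add: demazure_def)
qed (auto simp: demazure_snoc intro: demazure_step_closed)

lemma len_one [simp]: "len \<one> = 0"
  using len_le[of "[]"] by simp

lemma len_demazure_le: "w \<in> lists S \<Longrightarrow> len (demazure G S w) \<le> length w"
proof (induction w rule: rev_induct)
  case Nil
  show ?case by (simp add: demazure_def)
next
  case (snoc s w)
  then show ?case
    using len_mult_le[of "demazure G S w" s] demazure_closed[of w]
    by (auto simp: demazure_snoc demazure_step_def)
qed

text \<open>
  A step with \<open>s\<close> always ends in the longer one of \<open>k\<close> and \<open>k s\<close>, which has
  \<open>s\<close> as a descent.
\<close>

lemma demazure_step_eq_iff:
  assumes "h \<in> carrier G" "s \<in> S" "k \<in> carrier G"
  shows "demazure_step G S k s = h \<longleftrightarrow> len (h \<otimes> s) < len h \<and> (k = h \<or> k = h \<otimes> s)"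
  using assms len_mult_neq[of k s] by (auto simp: demazure_step_def)

text \<open>
  Both sides satisfy the same recursion on the last letter \<open>s\<close> of the word, with \<open>x\<close> the
  weight of its position: if \<open>s\<close> is a descent of \<open>h\<close>, then
  \<open>F (Q s) h = (1 - x) F Q h + x F Q (h s)\<close>, and otherwise \<open>F (Q s) h = F Q h\<close>.
  On the left the two cases are those of lemma \<open>reduced_subword_snoc\<close>.  On the right,
  a subword that uses the last letter has Demazure product \<open>h\<close> exactly when \<open>s\<close> is a descent
  of \<open>h\<close> and the remaining subword has Demazure product \<open>h\<close> or \<open>h s\<close>.  The additional letter
  changes the sign in the former case; in the latter this change is cancelled, because \<open>h\<close> is
  longer than \<open>h s\<close> by one.

  The exponent \<open>card P + len h\<close> has the parity of \<open>card P - len h\<close> and avoids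
  truncated subtraction in the recursion.
\<close>

lemma demazure_expansion:
  fixes w :: "nat \<Rightarrow> 'r::comm_ring_1"
  assumes "Q \<in> lists S" "h \<in> carrier G"
  shows "(\<Sum>P\<in>Pow {..<length Q}. if reduced_subword (nths Q P) h
        then (\<Prod>i\<in>P. w i) * (\<Prod>i\<in>{..<length Q} - P. 1 - w i) else 0)
    = (\<Sum>P\<in>Pow {..<length Q}. if demazure G S (nths Q P) = h
        then (- 1) ^ (card P + len h) * (\<Prod>i\<in>P. w i) else 0)"
proof -
  define K where "K Q h = (\<Sum>P\<in>Pow {..<length Q}. if reduced_subword (nths Q P) h
      then (\<Prod>i\<in>P. w i) * (\<Prod>i\<in>{..<length Q} - P. 1 - w i) else 0)" for Q h
  define D where "D Q h = (\<Sum>P\<in>Pow {..<length Q}. if demazure G S (nths Q P) = h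
      then (- 1) ^ (card P + len h) * (\<Prod>i\<in>P. w i) else 0)" for Q h
  have K_snoc: "K (Q @ [s]) h = (1 - w (length Q)) * K Q h
      + w (length Q) * K Q (if len (h \<otimes> s) < len h then h \<otimes> s else h)"
    if "Q \<in> lists S" "s \<in> S" "h \<in> carrier G" for Q s h
  proof -
    let ?n = "length Q" and ?h = "if len (h \<otimes> s) < len h then h \<otimes> s else h"
    have fin: "finite P" if "P \<in> Pow {..<?n}" for P
      using that finite_subset by blast
    have nn: "?n \<notin> P" if "P \<in> Pow {..<?n}" for P
      using that by auto
    have sub: "nths Q P \<in> lists S" for P
      using \<open>Q \<in> lists S\<close> set_nths_subset[of Q P] by auto
    have old: "{..<Suc ?n} - P = insert ?n ({..<?n} - P)" if "P \<in> Pow {..<?n}" for P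
      using that by auto
    have new: "{..<Suc ?n} - insert ?n P = {..<?n} - P" for P
      by auto
    show ?thesis
      unfolding K_def length_append_singleton sum_Pow_lessThan_Suc sum_distrib_left
      by (intro arg_cong2[where f = "(+)"] sum.cong refl)
        (use that sub in \<open>auto simp: nths_snoc_old nths_snoc_new reduced_subword_snoc old new fin nn mult_ac
           simp del: in_lists_conv_set\<close>)
  qed
  have D_snoc: "D (Q @ [s]) h = (if len (h \<otimes> s) < len h
      then D Q h + w (length Q) * (D Q (h \<otimes> s) - D Q h) else D Q h)"
    if "Q \<in> lists S" "s \<in> S" "h \<in> carrier G" for Q s h
  proof -
    let ?n = "length Q"
    have fin: "finite P" if "P \<in> Pow {..<?n}" for P
      using that finite_subset by blast
    have nn: "?n \<notin> P" if "P \<in> Pow {..<?n}" for P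
      using that by auto
    have clos: "demazure G S (nths Q P) \<in> carrier G" for P
      using \<open>Q \<in> lists S\<close> set_nths_subset[of Q P] by (intro demazure_closed) auto
    have "D (Q @ [s]) h = D Q h + (\<Sum>P\<in>Pow {..<?n}.
        if len (h \<otimes> s) < len h \<and> (demazure G S (nths Q P) = h \<or> demazure G S (nths Q P) = h \<otimes> s)
        then - w ?n * ((- 1) ^ (card P + len h) * (\<Prod>i\<in>P. w i)) else 0)"
      unfolding D_def length_append_singleton sum_Pow_lessThan_Suc
      by (intro arg_cong2[where f = "(+)"] sum.cong refl)
        (use that clos in \<open>auto simp: nths_snoc_old nths_snoc_new demazure_snoc demazure_step_eq_iff
           fin nn mult_ac\<close>)
    \<comment> \<open>Since \<open>h s\<close> differs from \<open>h\<close>, the two conditions on \<open>P\<close> are disjoint and the sum splits.\<close>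
    also have "(\<Sum>P\<in>Pow {..<?n}.
        if len (h \<otimes> s) < len h \<and> (demazure G S (nths Q P) = h \<or> demazure G S (nths Q P) = h \<otimes> s)
        then - w ?n * ((- 1) ^ (card P + len h) * (\<Prod>i\<in>P. w i)) else 0)
      = (if len (h \<otimes> s) < len h then w ?n * (D Q (h \<otimes> s) - D Q h) else 0)"
    proof (cases "len (h \<otimes> s) < len h")
      case True
      then have l: "len h = Suc (len (h \<otimes> s))"
        using len_mult_ge[of h s] that by simp
      then have "h \<otimes> s \<noteq> h"
        by auto
      then show ?thesis
        unfolding D_def using True
        by (auto simp: l sum_distrib_left simp flip: sum_subtractf intro!: sum.cong)
    qed auto
    finally show ?thesis
      by simp
  qed
  have "K Q h = D Q h"
    using assms
  proof (induction Q arbitrary: h rule: rev_induct)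
    case Nil
    have "subseq u [] \<longleftrightarrow> u = []" for u :: "'a list"
      by (cases u) auto
    then have "reduced_subword [] h \<longleftrightarrow> \<one> = h"
      unfolding reduced_subword_def by (metis word_prod_Nil len_one list.size(3))
    then show ?case
      by (auto simp: K_def D_def demazure_def)
  next
    case (snoc s Q)
    then have "Q \<in> lists S" "s \<in> S" "h \<otimes> s \<in> carrier G"
      by auto
    then show ?case
      using snoc by (simp add: K_snoc D_snoc algebra_simps)
  qed
  then show ?thesis
    by (simp add: K_def D_def)
qed

end

section \<open>Stanley--Reisner ideals and Hilbert series\<close>

lemma keys_add_nat: "Poly_Mapping.keys (a + b) = Poly_Mapping.keys a \<union> Poly_Mapping.keys b"
  for a b :: "'i \<Rightarrow>\<^sub>0 nat"
  by (auto simp: in_keys_iff lookup_add)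

lemma prod_mpoly_var:
  "finite D \<Longrightarrow> (\<Prod>i\<in>D. mpoly_var i :: 'k::field mpoly)
    = Poly_Mapping.single (\<Sum>i\<in>D. Poly_Mapping.single i 1) 1"
  by (induction rule: finite_induct) (auto simp: mpoly_var_def mult_single simp flip: single_one)

lemma lookup_sum_single:
  "finite D \<Longrightarrow> Poly_Mapping.lookup (\<Sum>i\<in>D. Poly_Mapping.single i (1::nat)) j = (if j \<in> D then 1 else 0)"
  by (simp add: lookup_sum lookup_single when_def)

text \<open>
  This is the monomial ideal generated by the squarefree monomials with support in \<open>N\<close>,
  described by the monomials of its members.  It bounds the Stanley--Reisner ideal from above.
\<close>

lemma ideal_supports:
  fixes N :: "nat set set"
  shows "ideal {p :: 'k::field mpoly. Poly_Mapping.keys p \<subseteq> monomials m \<and>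
    (\<forall>a\<in>Poly_Mapping.keys p. \<exists>D\<in>N. D \<subseteq> Poly_Mapping.keys a)} (mpoly_ring m)"
    (is "ideal ?J ?R")
proof -
  interpret R: cring ?R by (rule cring_mpoly_ring)
  have carr: "carrier ?R = {p. Poly_Mapping.keys p \<subseteq> monomials m}"
    by (simp add: mpoly_ring_def)
  have plus_eq: "p \<oplus>\<^bsub>?R\<^esub> q = p + q" and times_eq: "p \<otimes>\<^bsub>?R\<^esub> q = p * q" for p q
    by (simp_all add: mpoly_ring_def)
  have add: "p + q \<in> ?J" if "p \<in> ?J" "q \<in> ?J" for p q
    using that keys_add[of p q] by fast
  have mult: "p * q \<in> ?J" if p: "p \<in> ?J" and q: "q \<in> carrier ?R" for p q
  proof -
    have "p * q \<in> carrier ?R"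
      using R.m_closed[of p q] p q by (simp add: mpoly_ring_def)
    moreover have "\<exists>D\<in>N. D \<subseteq> Poly_Mapping.keys a" if a: "a \<in> Poly_Mapping.keys (p * q)" for a
    proof -
      obtain b c where "b \<in> Poly_Mapping.keys p" "a = b + c"
        using subsetD[OF keys_mult a] by blast
      moreover from this obtain D where "D \<in> N" "D \<subseteq> Poly_Mapping.keys b"
        using p by auto
      ultimately show ?thesis
        by (intro bexI[of _ D]) (auto simp: keys_add_nat)
    qed
    ultimately show ?thesis
      by (simp add: carr)
  qed
  have minus: "\<ominus>\<^bsub>?R\<^esub> p = - p" if "p \<in> carrier ?R" for p
    using that by (intro R.minus_equality) (auto simp: mpoly_ring_def)
  show ?thesis
  proof (rule idealI)
    show "subgroup ?J (add_monoid ?R)"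
    proof (rule R.add.subgroupI)
      show "?J \<noteq> {}"
        by (auto intro: exI[of _ 0])
      show "\<ominus>\<^bsub>?R\<^esub> p \<in> ?J" if "p \<in> ?J" for p
        using minus[of p] that by (simp add: carr)
      show "\<And>p q. \<lbrakk>p \<in> ?J; q \<in> ?J\<rbrakk> \<Longrightarrow> p \<oplus>\<^bsub>?R\<^esub> q \<in> ?J"
        unfolding plus_eq by (rule add)
    qed (auto simp: carr)
  next
    fix p q assume pq: "p \<in> ?J" "q \<in> carrier ?R"
    then show "p \<otimes>\<^bsub>?R\<^esub> q \<in> ?J"
      unfolding times_eq by (rule mult)
    from mult[OF pq] show "q \<otimes>\<^bsub>?R\<^esub> p \<in> ?J"
      unfolding times_eq by (simp only: mult.commute)
  qed (rule R.ring_axioms)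
qed

text \<open>
  A monomial of the ideal is divisible by a squarefree monomial whose support \<open>D\<close> is a nonface;
  then its own support contains \<open>D\<close>, and is a nonface because \<open>\<Delta>\<close> is closed
  under subsets.  Conversely a monomial is a multiple of the squarefree monomial on its support.
\<close>

lemma monomial_in_stanley_reisner_ideal_iff:
  assumes a: "a \<in> monomials m"
    and down: "\<And>E F. \<lbrakk>F \<in> \<Delta>; E \<subseteq> F\<rbrakk> \<Longrightarrow> E \<in> \<Delta>"
  shows "(Poly_Mapping.single a 1 :: 'k::field mpoly) \<in> stanley_reisner_ideal m \<Delta> \<longleftrightarrow>
    Poly_Mapping.keys a \<notin> \<Delta>"
proof -
  let ?R = "mpoly_ring m :: 'k mpoly ring"
  let ?N = "{D. D \<subseteq> {..<m} \<and> D \<notin> \<Delta>}"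
  let ?gens = "{\<Prod>i\<in>D. mpoly_var i :: 'k mpoly | D. D \<subseteq> {..<m} \<and> D \<notin> \<Delta>}"
  let ?e = "\<lambda>D. \<Sum>i\<in>D. Poly_Mapping.single i (1::nat)"
  interpret R: cring ?R by (rule cring_mpoly_ring)
  have fin: "finite D" if "D \<subseteq> {..<m}" for D :: "nat set"
    using that finite_subset by blast
  have keys_e: "Poly_Mapping.keys (?e D) = D" if "D \<subseteq> {..<m}" for D
    using lookup_sum_single[OF fin[OF that]] by (auto simp: in_keys_iff split: if_splits)
  have gen: "(\<Prod>i\<in>D. mpoly_var i) = (Poly_Mapping.single (?e D) 1 :: 'k mpoly)"
    if "D \<subseteq> {..<m}" for D
    using prod_mpoly_var fin that by blast
  have gens_carrier: "?gens \<subseteq> carrier ?R"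
    using keys_e by (auto simp: gen mpoly_ring_def monomials_def)
  show ?thesis
  proof
    assume in_I: "(Poly_Mapping.single a 1 :: 'k mpoly) \<in> stanley_reisner_ideal m \<Delta>"
    have "stanley_reisner_ideal m \<Delta> \<subseteq> {p :: 'k mpoly. Poly_Mapping.keys p \<subseteq> monomials m \<and>
        (\<forall>a\<in>Poly_Mapping.keys p. \<exists>D\<in>?N. D \<subseteq> Poly_Mapping.keys a)}"
      unfolding stanley_reisner_ideal_def
      by (intro R.genideal_minimal ideal_supports) (use keys_e in \<open>auto simp: gen monomials_def\<close>)
    from subsetD[OF this in_I] obtain D where "D \<notin> \<Delta>" "D \<subseteq> Poly_Mapping.keys a"
      by auto
    then show "Poly_Mapping.keys a \<notin> \<Delta>"
      using down by blast
  next
    let ?D = "Poly_Mapping.keys a"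
    assume notin: "?D \<notin> \<Delta>"
    have D: "?D \<subseteq> {..<m}"
      using a by (simp add: monomials_def)
    interpret I: ideal "stanley_reisner_ideal m \<Delta> :: 'k mpoly set" ?R
      unfolding stanley_reisner_ideal_def using gens_carrier by (rule R.genideal_ideal)
    have "(\<Prod>i\<in>?D. mpoly_var i) \<in> (stanley_reisner_ideal m \<Delta> :: 'k mpoly set)"
      unfolding stanley_reisner_ideal_def using R.genideal_self[OF gens_carrier] D notin by blast
    moreover have "Poly_Mapping.single (a - ?e ?D) 1 \<in> carrier ?R"
    proof -
      have "Poly_Mapping.keys (a - ?e ?D) \<subseteq> ?D"
        by (auto simp: in_keys_iff lookup_minus)
      then show ?thesis
        using D by (auto simp: mpoly_ring_def monomials_def)
    qed
    ultimately have "(\<Prod>i\<in>?D. mpoly_var i) \<otimes>\<^bsub>?R\<^esub> Poly_Mapping.single (a - ?e ?D) 1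
        \<in> stanley_reisner_ideal m \<Delta>"
      by (rule I.I_r_closed)
    moreover have "?e ?D + (a - ?e ?D) = a"
      by (intro poly_mapping_eqI)
        (use lookup_sum_single[of ?D] in \<open>auto simp: lookup_add lookup_minus in_keys_iff\<close>)
    ultimately show "(Poly_Mapping.single a 1 :: 'k mpoly) \<in> stanley_reisner_ideal m \<Delta>"
      by (simp add: gen[OF D] mpoly_ring_def mult_single)
  qed
qed

lemma mfps_nth_simps [simp]:
  "mfps_nth 0 a = 0"
  "mfps_nth (f + g) a = mfps_nth f a + mfps_nth g a"
  "mfps_nth (f - g) a = mfps_nth f a - mfps_nth g a"
  by (simp_all add: zero_mfps.rep_eq plus_mfps.rep_eq minus_mfps.rep_eq)

lemma mfps_nth_sum: "mfps_nth (\<Sum>x\<in>A. f x) a = (\<Sum>x\<in>A. mfps_nth (f x) a)"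
  by (induction A rule: infinite_finite_induct) auto

lemma mfps_nth_var_mult:
  fixes f :: "('i, 'a::comm_ring_1) mfps"
  shows "mfps_nth (mfps_var i * f) a =
    (if i \<in> Poly_Mapping.keys a then mfps_nth f (a - Poly_Mapping.single i 1) else 0)"
proof -
  let ?e = "Poly_Mapping.single i (1::nat)"
  have nth: "mfps_nth (mfps_var i * f) a = (\<Sum>(b, c)\<in>splits a. if b = ?e then mfps_nth f c else 0)"
    by (auto simp: times_mfps.rep_eq mfps_var_def intro!: sum.cong)
  show ?thesis
  proof (cases "i \<in> Poly_Mapping.keys a")
    case True
    have "?e + (a - ?e) = a"
      using True by (intro poly_mapping_eqI)
        (auto simp: lookup_add lookup_minus lookup_single when_def in_keys_iff)
    then have "(\<Sum>(b, c)\<in>splits a. if b = ?e then mfps_nth f c else 0)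
        = (\<Sum>(b, c)\<in>{(?e, a - ?e)}. if b = ?e then mfps_nth f c else 0)"
      by (intro sum.mono_neutral_right) (auto simp: in_splits_iff split: if_splits)
    then show ?thesis
      using True nth by simp
  next
    case False
    then have "(\<Sum>(b, c)\<in>splits a. if b = ?e then mfps_nth f c else 0) = 0"
      by (intro sum.neutral) (auto simp: in_splits_iff keys_add_nat)
    then show ?thesis
      using False nth by simp
  qed
qed

text \<open>
  The sum of all monomials with support exactly \<open>F\<close>, that is, the product of
  \<open>z\<^sub>i / (1 - z\<^sub>i)\<close> over \<open>i \<in> F\<close>.
\<close>

definition support_series :: "'i set \<Rightarrow> ('i, 'a::comm_ring_1) mfps" where
  "support_series F = Abs_mfps (\<lambda>a. if Poly_Mapping.keys a = F then 1 else 0)"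

lemma mfps_nth_support_series:
  "mfps_nth (support_series F :: ('i, 'a::comm_ring_1) mfps) a
    = (if Poly_Mapping.keys a = F then 1 else 0)"
  by (simp add: support_series_def)

text \<open>
  Multiplication by \<open>1 - z\<^sub>i\<close> telescopes the positive powers of \<open>z\<^sub>i\<close> and leaves the
  lowest one, \<open>z\<^sub>i\<close> itself.
\<close>

lemma support_series_insert:
  assumes "i \<notin> F"
  shows "support_series (insert i F) * (1 - mfps_var i)
    = (mfps_var i * support_series F :: ('i, 'a::comm_ring_1) mfps)"
proof (rule mfps_eqI)
  fix a :: "'i \<Rightarrow>\<^sub>0 nat"
  let ?e = "Poly_Mapping.single i (1::nat)"
  have "mfps_nth (support_series (insert i F) * (1 - mfps_var i)) a
      = mfps_nth (support_series (insert i F) :: ('i, 'a) mfps) a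
        - mfps_nth (mfps_var i * support_series (insert i F)) a"
    by (simp add: mult.commute[of "support_series (insert i F)"] left_diff_distrib)
  also have "\<dots> = mfps_nth (mfps_var i * support_series F) a"
  proof (cases "i \<in> Poly_Mapping.keys a")
    case True
    \<comment> \<open>Divide the monomial by \<open>z\<^sub>i\<close>; its support is preserved or loses \<open>i\<close>.\<close>
    define b where "b = a - ?e"
    have "?e + b = a"
      using True unfolding b_def by (intro poly_mapping_eqI)
        (auto simp: lookup_add lookup_minus lookup_single when_def in_keys_iff)
    then have "Poly_Mapping.keys a = insert i (Poly_Mapping.keys b)"
      using keys_add_nat[of ?e b] by simp
    then have "Poly_Mapping.keys a = insert i F \<longleftrightarrow>
        Poly_Mapping.keys b = insert i F \<or> Poly_Mapping.keys b = F"
      using assms by (metis insert_absorb insert_absorb2 insert_ident)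
    moreover have "insert i F \<noteq> F"
      using assms by blast
    ultimately show ?thesis
      unfolding mfps_nth_var_mult mfps_nth_support_series b_def[symmetric] using True by simp
  next
    case False
    then have "Poly_Mapping.keys a \<noteq> insert i F"
      by blast
    then show ?thesis
      unfolding mfps_nth_var_mult mfps_nth_support_series using False by simp
  qed
  finally show "mfps_nth (support_series (insert i F) * (1 - mfps_var i)) a
      = mfps_nth (mfps_var i * support_series F :: ('i, 'a) mfps) a" .
qed

lemma support_series_mult:
  "finite F \<Longrightarrow> support_series F * (\<Prod>i\<in>F. 1 - mfps_var i)
    = (\<Prod>i\<in>F. mfps_var i :: ('i, 'a::comm_ring_1) mfps)"
proof (induction rule: finite_induct)
  case empty
  show ?case
    by (auto intro!: mfps_eqI simp: support_series_def one_mfps.rep_eq)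
next
  case (insert i F)
  have "support_series (insert i F) * (\<Prod>i\<in>insert i F. 1 - mfps_var i)
      = (support_series (insert i F) * (1 - mfps_var i)) * (\<Prod>i\<in>F. 1 - mfps_var i)"
    using insert by (simp add: mult.assoc)
  also have "\<dots> = mfps_var i * (support_series F * (\<Prod>i\<in>F. 1 - mfps_var i :: ('i, 'a) mfps))"
    using insert by (simp add: support_series_insert mult.assoc)
  finally show ?case
    using insert by simp
qed

text \<open>
  The monomials outside the ideal are those whose support is a face, so the Hilbert series is the
  sum of the support series of the faces.  Clearing denominators gives each face \<open>F\<close> the
  numerator \<open>z^F (1 - z)^(complement of F)\<close>.
\<close>

lemma hilbert_series_numerator:
  assumes sub: "\<Delta> \<subseteq> Pow {..<m}" and down: "\<And>E F. \<lbrakk>F \<in> \<Delta>; E \<subseteq> F\<rbrakk> \<Longrightarrow> E \<in> \<Delta>"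
  shows "hilbert_series m (stanley_reisner_ideal m \<Delta> :: 'k::field mpoly set)
      * (\<Prod>i<m. 1 - mfps_var i)
    = (\<Sum>F\<in>\<Delta>. (\<Prod>i\<in>F. mfps_var i) * (\<Prod>i\<in>{..<m} - F. 1 - mfps_var i))"
proof -
  have fin: "finite \<Delta>"
    using sub by (rule finite_subset) simp
  have "hilbert_series m (stanley_reisner_ideal m \<Delta> :: 'k mpoly set) = (\<Sum>F\<in>\<Delta>. support_series F)"
  proof (rule mfps_eqI)
    fix a
    have "(a \<in> monomials m \<and> Poly_Mapping.single a 1 \<notin> (stanley_reisner_ideal m \<Delta> :: 'k mpoly set))
        \<longleftrightarrow> Poly_Mapping.keys a \<in> \<Delta>"
      using monomial_in_stanley_reisner_ideal_iff[of a m \<Delta>] down sub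
      by (auto simp: monomials_def)
    then show "mfps_nth (hilbert_series m (stanley_reisner_ideal m \<Delta> :: 'k mpoly set)) a
        = mfps_nth (\<Sum>F\<in>\<Delta>. support_series F) a"
      using fin by (simp add: hilbert_series_def mfps_nth_sum support_series_def)
  qed
  also have "\<dots> * (\<Prod>i<m. 1 - mfps_var i)
      = (\<Sum>F\<in>\<Delta>. (\<Prod>i\<in>F. mfps_var i) * (\<Prod>i\<in>{..<m} - F. 1 - mfps_var i))"
    unfolding sum_distrib_right
  proof (rule sum.cong)
    fix F assume "F \<in> \<Delta>"
    then have F: "F \<subseteq> {..<m}" "finite F"
      using sub finite_subset by auto
    have "(\<Prod>i<m. 1 - mfps_var i :: (nat, int) mfps)
        = (\<Prod>i\<in>F. 1 - mfps_var i) * (\<Prod>i\<in>{..<m} - F. 1 - mfps_var i)"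
      using F(1) by (subst prod.subset_diff[OF F(1)]) (auto simp: mult.commute)
    then show "support_series F * (\<Prod>i<m. 1 - mfps_var i :: (nat, int) mfps)
        = (\<Prod>i\<in>F. mfps_var i) * (\<Prod>i\<in>{..<m} - F. 1 - mfps_var i)"
      using support_series_mult[OF F(2), where 'a = int] by (metis mult.assoc)
  qed simp
  finally show ?thesis .
qed

lemma mfps_eq_divideI:
  fixes f g h :: "('i, 'a::comm_ring_1) mfps"
  assumes "g dvd 1" "f * g = h"
  shows "f = h / g"
  using assms mfps_mult_inverse[of g] by (simp add: divide_mfps_def mult.assoc flip: assms(2))

lemma prod_one_minus_mfps_var_unit:
  "(\<Prod>i\<in>A. 1 - mfps_var i :: ('i, 'a::comm_ring_1) mfps) dvd 1"
proof (induction A rule: infinite_finite_induct)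
  case (insert i A)
  then show ?case
    using mult_dvd_mono[OF one_minus_mfps_var_unit insert.IH, of i] by simp
qed auto

section \<open>The Hilbert series of a subword complex\<close>

theorem theorem4p1:
  fixes G :: "('a, 'b) monoid_scheme" and S :: "'a set" and Q :: "'a list" and g :: 'a
  assumes "coxeter_system G S" and "Q \<in> lists S" and "g \<in> carrier G"
  shows "hilbert_series (length Q)
      (stanley_reisner_ideal (length Q) (subword_complex G S Q g) :: 'k::field mpoly set) =
    (\<Sum>P | P \<subseteq> {..<length Q} \<and> demazure G S (nths Q P) = g.
        (- 1) ^ (card P - cox_length G S g) * (\<Prod>i\<in>P. 1 - mfps_var i))
    / (\<Prod>i<length Q. 1 - mfps_var i)"
proof (rule mfps_eq_divideI[OF prod_one_minus_mfps_var_unit])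
  interpret coxeter_system G S by fact
  let ?M = "{..<length Q}" and ?\<Delta> = "subword_complex G S Q g"
  let ?z = "mfps_var :: nat \<Rightarrow> (nat, int) mfps"
  let ?C = "{P. P \<subseteq> ?M \<and> reduced_subword (nths Q P) g}"
  have \<Delta>: "?\<Delta> = (\<lambda>P. ?M - P) ` ?C"
    by (auto simp: subword_complex_def contains_iff_reduced_subword)
  \<comment> \<open>Shrinking a face enlarges its complement, which still contains \<open>g\<close>.\<close>
  have down: "E \<in> ?\<Delta>" if "F \<in> ?\<Delta>" "E \<subseteq> F" for E F
  proof -
    from that(1) obtain P where P: "P \<subseteq> ?M" "contains G S Q P g" "F = ?M - P"
      by (auto simp: subword_complex_def)
    then have "contains G S Q (?M - E) g" and "E = ?M - (?M - E)"
      using that(2) unfolding contains_def by blast+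
    then show ?thesis
      unfolding subword_complex_def by blast
  qed
  have "hilbert_series (length Q) (stanley_reisner_ideal (length Q) ?\<Delta> :: 'k mpoly set)
        * (\<Prod>i\<in>?M. 1 - ?z i)
      = (\<Sum>F\<in>?\<Delta>. (\<Prod>i\<in>F. ?z i) * (\<Prod>i\<in>?M - F. 1 - ?z i))"
    using down by (intro hilbert_series_numerator) (auto simp: \<Delta>)
  \<comment> \<open>Index the faces by their complements and write \<open>z = 1 - (1 - z)\<close>, so that only the weights \<open>1 - z\<close> occur.\<close>
  also have "\<dots> = (\<Sum>P\<in>?C. (\<Prod>i\<in>P. 1 - ?z i) * (\<Prod>i\<in>?M - P. 1 - (1 - ?z i)))"
    unfolding \<Delta> by (subst sum.reindex) (auto intro!: inj_onI sum.cong simp: double_diff mult.commute)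
  also have "\<dots> = (\<Sum>P\<in>Pow ?M. if reduced_subword (nths Q P) g
      then (\<Prod>i\<in>P. 1 - ?z i) * (\<Prod>i\<in>?M - P. 1 - (1 - ?z i)) else 0)"
    by (subst sum.inter_filter[symmetric]) (auto intro: sum.cong)
  also have "\<dots> = (\<Sum>P\<in>Pow ?M. if demazure G S (nths Q P) = g
      then (- 1) ^ (card P + len g) * (\<Prod>i\<in>P. 1 - ?z i) else 0)"
    using assms by (intro demazure_expansion)
  also have "\<dots> = (\<Sum>P | P \<subseteq> ?M \<and> demazure G S (nths Q P) = g.
      (- 1) ^ (card P + len g) * (\<Prod>i\<in>P. 1 - ?z i))"
    by (subst sum.inter_filter[symmetric]) (auto intro: sum.cong)
  also have "\<dots> = (\<Sum>P | P \<subseteq> ?M \<and> demazure G S (nths Q P) = g.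
      (- 1) ^ (card P - len g) * (\<Prod>i\<in>P. 1 - ?z i))"
  proof (intro sum.cong arg_cong2[where f = "(*)"])
    fix P assume P: "P \<in> {P. P \<subseteq> ?M \<and> demazure G S (nths Q P) = g}"
    then have "{i. i < length Q \<and> i \<in> P} = P"
      by auto
    \<comment> \<open>The Demazure product is at most as long as its word, so the subtraction in the exponent does not truncate.\<close>
    then have "len g \<le> card P"
      using P len_demazure_le[of "nths Q P"] set_nths_subset[of Q P] assms(2)
      by (auto simp: length_nths)
    then show "(- 1 :: (nat, int) mfps) ^ (card P + len g) = (- 1) ^ (card P - len g)"
      by (simp add: minus_one_power_iff)
  qed simp_all
  finally show "hilbert_series (length Q) (stanley_reisner_ideal (length Q) ?\<Delta> :: 'k mpoly set)
        * (\<Prod>i\<in>?M. 1 - ?z i)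
      = (\<Sum>P | P \<subseteq> ?M \<and> demazure G S (nths Q P) = g.
          (- 1) ^ (card P - len g) * (\<Prod>i\<in>P. 1 - ?z i))" .
qed

end
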